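(* Let $n\ge 4$, let $R$ be a $p_2$-orientation of $P_n$, and let $3\le k\le n-1$ (so that $v_k$ and $v_{k-1}$ each have exactly two neighbours). Consider the triple $(e_k,e_{k-1},e_{k-2})$ of edge orientations (each right, left or flat). Then exactly one of the following holds, and the multiplier of $v_k$ is as stated (for every admissible choice of stack sizes $a_1,\dots,a_{k-1}$): Multiplier 3: the triple is (left, right, left) or (right, left, right). Multiplier 2: the triple is (left, right, flat), (right, left, flat), (flat, right, left) or (flat, left, right). Multiplier 1: the triple is (left, right, right), (right, left, left), (left, left, right), (right, right, left), (flat, right, flat), (flat, left, flat), (left, flat, right) or (right, flat, left).
   Context: Parallel Diffusion on a finite simple graph $G$: a configuration assigns an integer stack size $|v|$ (possibly negative) to each vertex. In one step all vertices fire simultaneously: each vertex sends one chip to each neighbour with strictly smaller stack size. Starting from $C_0$, $C_{t+1}$ is obtained from $C_t$ by one step. A configuration $D$ is a $p_2$-configuration if there are $C_0$ and $N$ such that $C_{t+2}=C_t$ and $C_{t+1}\ne C_t$ for all $t\ge N$, and $D=C_t$ for some $t\ge N$. The path $P_n$ has vertices $v_1,\dots,v_n$ and edges $e_i=v_iv_{i+1}$, drawn horizontally with $v_1$ rightmost. A configuration induces the orientation in which each edge is directed from its endpoint with larger stack size to its endpoint with smaller stack size, and is flat if equal; a $p_2$-orientation is one induced by a $p_2$-configuration. A directed edge $e_i$ is a right edge if directed $v_{i+1}\to v_i$ and a left edge if directed $v_i\to v_{i+1}$. Convention: only configurations with $|v_1|=0$ are considered. Multiplier: for a $p_2$-orientation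 $R$, an index $k$, and integers $a_1,\dots,a_{k-1}$ that are admissible (there is a $p_2$-configuration $C$ inducing $R$ with $|v_1|^C=0$ and $|v_i|^C=a_i$ for $i<k$), the multiplier of $v_k$ is the number of integers $b$ for which there is a $p_2$-configuration $C$ inducing $R$ with $|v_1|^C=0$, $|v_i|^C=a_i$ for $i<k$, and $|v_k|^C=b$. *)

theory Defs
  imports Main "Graph_Theory.Pair_Digraph"
begin

text \<open>
  A finite simple graph is a \<open>pair_graph\<close>: a finite, loop-free, symmetric set of
  arcs, so that an undirected edge \<open>uv\<close> is the pair of arcs \<open>(u, v)\<close> and \<open>(v, u)\<close>.
  A configuration is a function to \<open>int\<close> of which only the values on the vertices matter;
  configurations are therefore compared with \<open>same_config\<close> and not with \<open>=\<close>.
\<close>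

abbreviation same_config :: "'a pair_pre_digraph \<Rightarrow> ('a \<Rightarrow> int) \<Rightarrow> ('a \<Rightarrow> int) \<Rightarrow> bool" where
  "same_config G C D \<equiv> \<forall>v\<in>pverts G. C v = D v"

definition fire :: "'a pair_pre_digraph \<Rightarrow> ('a \<Rightarrow> int) \<Rightarrow> ('a \<Rightarrow> int)" where
  "fire G C = (\<lambda>v. C v - int (card {u. (v, u) \<in> parcs G \<and> C u < C v})
                      + int (card {u. (u, v) \<in> parcs G \<and> C v < C u}))"

definition p2_configuration :: "'a pair_pre_digraph \<Rightarrow> ('a \<Rightarrow> int) \<Rightarrow> bool" where
  "p2_configuration G D \<longleftrightarrow>
     (\<exists>C\<^sub>0 N. (\<forall>t\<ge>N. same_config G ((fire G ^^ (t + 2)) C\<^sub>0) ((fire G ^^ t) C\<^sub>0) \<and>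
                     \<not> same_config G ((fire G ^^ (t + 1)) C\<^sub>0) ((fire G ^^ t) C\<^sub>0)) \<and>
             (\<exists>t\<ge>N. same_config G D ((fire G ^^ t) C\<^sub>0)))"

text \<open>
  An orientation is the set of its arcs \<open>(tail, head)\<close>; an edge is flat
  when neither of its two arcs is present.
\<close>

definition induced_orientation :: "'a pair_pre_digraph \<Rightarrow> ('a \<Rightarrow> int) \<Rightarrow> 'a rel" where
  "induced_orientation G C = {(u, v) \<in> parcs G. C v < C u}"

definition p2_orientation :: "'a pair_pre_digraph \<Rightarrow> 'a rel \<Rightarrow> bool" where
  "p2_orientation G R \<longleftrightarrow> (\<exists>C. p2_configuration G C \<and> induced_orientation G C = R)"

text \<open>The vertex \<open>v\<^sub>i\<close> of the path is the number \<open>i\<close>, and \<open>e\<^sub>i\<close> joins \<open>i\<close> to \<open>Suc i\<close>.\<close>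

definition path_graph :: "nat \<Rightarrow> nat pair_pre_digraph" where
  "path_graph n = \<lparr> pverts = {1..n},
     parcs = {(i, j). i \<in> {1..n} \<and> j \<in> {1..n} \<and> (j = Suc i \<or> i = Suc j)} \<rparr>"

lemma pair_graph_path_graph: "pair_graph (path_graph n)"
proof
  show "finite (parcs (path_graph n))"
    by (rule finite_subset[of _ "{1..n} \<times> {1..n}"]) (auto simp: path_graph_def)
qed (auto simp: path_graph_def symmetric_def sym_def)

datatype edge_type = Right | Left | Flat

text \<open>The vertex \<open>v\<^sub>1\<close> is drawn rightmost, so an arc towards the smaller index points right.\<close>

definition edge_type :: "nat rel \<Rightarrow> nat \<Rightarrow> edge_type" where
  "edge_type R i = (if (Suc i, i) \<in> R then Right else if (i, Suc i) \<in> R then Left else Flat)"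

text \<open>
  The \<open>p\<^sub>2\<close>-configurations \<open>C\<close> of the path with \<open>n\<close> vertices that induce \<open>R\<close>, are normalised by
  \<open>C 1 = 0\<close>, and have the prescribed stack sizes \<open>a i\<close> on the vertices \<open>i < k\<close>.
\<close>

definition p2_extension :: "nat \<Rightarrow> nat rel \<Rightarrow> nat \<Rightarrow> (nat \<Rightarrow> int) \<Rightarrow> (nat \<Rightarrow> int) \<Rightarrow> bool" where
  "p2_extension n R k a C \<longleftrightarrow>
     p2_configuration (path_graph n) C \<and> induced_orientation (path_graph n) C = R \<and>
     C 1 = 0 \<and> (\<forall>i\<in>{1..<k}. C i = a i)"

definition admissible :: "nat \<Rightarrow> nat rel \<Rightarrow> nat \<Rightarrow> (nat \<Rightarrow> int) \<Rightarrow> bool" where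
  "admissible n R k a \<longleftrightarrow> (\<exists>C. p2_extension n R k a C)"

definition multiplier :: "nat \<Rightarrow> nat rel \<Rightarrow> nat \<Rightarrow> (nat \<Rightarrow> int) \<Rightarrow> nat" where
  "multiplier n R k a = card {b. \<exists>C. p2_extension n R k a C \<and> C k = b}"

end

theory Submission
  imports Defs
begin

text \<open>
  Write \<open>s\<^sub>i \<in> {-1, 0, 1}\<close> for the number of chips crossing \<open>e\<^sub>i\<close> to the right and
  \<open>x\<^sub>i = |v\<^sub>i\<^sub>+\<^sub>1| - |v\<^sub>i|\<close>, so that \<open>s\<^sub>i = sgn x\<^sub>i\<close>.  A step replaces \<open>x\<^sub>i\<close> by
  \<open>x\<^sub>i + s\<^sub>i\<^sub>+\<^sub>1 + s\<^sub>i\<^sub>-\<^sub>1 - 2 s\<^sub>i\<close>.  On a path, period two forces every edge to reverse (start at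
  the end \<open>v\<^sub>1\<close>), so a configuration is a \<open>p\<^sub>2\<close>-configuration iff it is not constant and
  \<open>sgn (x\<^sub>i + s\<^sub>i\<^sub>+\<^sub>1 + s\<^sub>i\<^sub>-\<^sub>1 - 2 s\<^sub>i) = - s\<^sub>i\<close> for all \<open>i\<close>.  For a fixed orientation these are
  independent conditions on the single \<open>x\<^sub>i\<close>, and the one for \<open>i = k - 1\<close> has, if any,
  \<open>1 - s\<^sub>i (s\<^sub>i\<^sub>+\<^sub>1 + s\<^sub>i\<^sub>-\<^sub>1)\<close> solutions.  Two consecutive flat edges would propagate along the
  path and make the configuration constant.
\<close>

section \<open>Period two on an arbitrary graph\<close>

text \<open>Arcs join vertices only, so values off the vertex set never influence a step
  there.\<close>

lemma fire_cong:
  assumes "pair_graph G" "same_config G C D"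
  shows "same_config G (fire G C) (fire G D)"
proof
  interpret pair_graph G by fact
  fix v assume v: "v \<in> pverts G"
  have "{u. (v, u) \<in> parcs G \<and> C u < C v} = {u. (v, u) \<in> parcs G \<and> D u < D v}"
    "{u. (u, v) \<in> parcs G \<and> C v < C u} = {u. (u, v) \<in> parcs G \<and> D v < D u}"
    using assms(2) v by (auto dest: in_arcsD1 in_arcsD2)
  then show "fire G C v = fire G D v"
    using assms(2) v by (simp add: fire_def)
qed

text \<open>\<open>D\<close> agrees on the vertices with a state of the periodic tail and so
  inherits its behaviour; conversely \<open>D\<close> itself, with \<open>N = 0\<close>, is a
  starting configuration.\<close>

lemma p2_configuration_iff:
  assumes "pair_graph G"
  shows "p2_configuration G D \<longleftrightarrow>
    same_config G (fire G (fire G D)) D \<and> \<not> same_config G (fire G D) D"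
proof
  assume "p2_configuration G D"
  then obtain C N t where
    ev: "\<forall>t\<ge>N. same_config G ((fire G ^^ (t + 2)) C) ((fire G ^^ t) C) \<and>
      \<not> same_config G ((fire G ^^ (t + 1)) C) ((fire G ^^ t) C)" and
    t: "t \<ge> N" and D: "same_config G D ((fire G ^^ t) C)"
    unfolding p2_configuration_def by blast
  have per: "same_config G (fire G (fire G ((fire G ^^ t) C))) ((fire G ^^ t) C)"
      "\<not> same_config G (fire G ((fire G ^^ t) C)) ((fire G ^^ t) C)"
    using ev t by (simp_all add: numeral_2_eq_2)
  have D1: "same_config G (fire G D) (fire G ((fire G ^^ t) C))"
    by (rule fire_cong[OF assms D])
  have D2: "same_config G (fire G (fire G D)) (fire G (fire G ((fire G ^^ t) C)))"
    by (rule fire_cong[OF assms D1])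
  show "same_config G (fire G (fire G D)) D \<and> \<not> same_config G (fire G D) D"
    using per D D1 D2 by simp
next
  assume D: "same_config G (fire G (fire G D)) D \<and> \<not> same_config G (fire G D) D"
  have "same_config G ((fire G ^^ (t + 2)) D) ((fire G ^^ t) D) \<and>
    \<not> same_config G ((fire G ^^ (t + 1)) D) ((fire G ^^ t) D)" for t
  proof (induction t)
    case 0
    then show ?case using D by (simp add: numeral_2_eq_2)
  next
    case (Suc t)
    have "same_config G ((fire G ^^ (Suc t + 2)) D) ((fire G ^^ Suc t) D)"
      using fire_cong[OF assms, of "(fire G ^^ (t + 2)) D" "(fire G ^^ t) D"] Suc.IH by simp
    \<comment> \<open>If states \<open>t + 2\<close> and \<open>t + 1\<close> agreed, then state
      \<open>t\<close>, which equals state \<open>t + 2\<close>, would be fixed.\<close>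
    moreover have "\<not> same_config G ((fire G ^^ (t + 2)) D) ((fire G ^^ (t + 1)) D)"
      using Suc.IH by simp metis
    ultimately show ?case by (simp add: numeral_2_eq_2)
  qed
  then show "p2_configuration G D"
    unfolding p2_configuration_def
    by (intro exI[of _ D] exI[of _ 0]) (auto intro: exI[of _ 0])
qed

section \<open>Flows along the path\<close>

text \<open>This is \<open>s\<^sub>i\<close>, read off the orientation so that all configurations
  inducing \<open>R\<close> share it.\<close>

definition flow :: "nat rel \<Rightarrow> nat \<Rightarrow> int" where
  "flow R i = (case edge_type R i of Right \<Rightarrow> 1 | Left \<Rightarrow> -1 | Flat \<Rightarrow> 0)"

abbreviation path_flow :: "nat \<Rightarrow> (nat \<Rightarrow> int) \<Rightarrow> nat \<Rightarrow> int" where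
  "path_flow n C \<equiv> flow (induced_orientation (path_graph n) C)"

lemma path_flow_eq:
  "path_flow n C i = (if i \<in> {1..<n} then sgn (C (Suc i) - C i) else 0)"
  by (auto simp: flow_def edge_type_def induced_orientation_def path_graph_def sgn_if)

lemma induced_orientation_path_eq_iff:
  "induced_orientation (path_graph n) C = induced_orientation (path_graph n) D \<longleftrightarrow>
    (\<forall>i\<in>{1..<n}. sgn (C (Suc i) - C i) = sgn (D (Suc i) - D i))"
proof
  assume "induced_orientation (path_graph n) C = induced_orientation (path_graph n) D"
  then have eq: "path_flow n C i = path_flow n D i" for i by simp
  show "\<forall>i\<in>{1..<n}. sgn (C (Suc i) - C i) = sgn (D (Suc i) - D i)"
  proof
    fix i assume "i \<in> {1..<n}"
    then show "sgn (C (Suc i) - C i) = sgn (D (Suc i) - D i)"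
      using eq[of i] by (simp add: path_flow_eq)
  qed
next
  assume sgn: "\<forall>i\<in>{1..<n}. sgn (C (Suc i) - C i) = sgn (D (Suc i) - D i)"
  have "C i < C (Suc i) \<longleftrightarrow> D i < D (Suc i)" "C (Suc i) < C i \<longleftrightarrow> D (Suc i) < D i"
    if "1 \<le> i" "Suc i \<le> n" for i
    using bspec[OF sgn, of i] that by (auto simp: sgn_if split: if_splits)
  then show "induced_orientation (path_graph n) C = induced_orientation (path_graph n) D"
    by (auto simp: induced_orientation_def path_graph_def)
qed

text \<open>Vertex \<open>i\<close> gains what crosses its left edge rightwards and loses what
  crosses its right edge. The end vertices fit the formula because the flow is 0 at the indices
  \<open>0\<close> and \<open>n\<close>.\<close>

lemma fire_path_graph:
  assumes "i \<in> {1..n}"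
  shows "fire (path_graph n) C i = C i + path_flow n C i - path_flow n C (i - 1)"
proof -
  have out: "{u. (i, u) \<in> parcs (path_graph n) \<and> C u < C i} =
      (if i < n \<and> C (Suc i) < C i then {Suc i} else {}) \<union>
      (if 1 < i \<and> C (i - 1) < C i then {i - 1} else {})"
    using assms by (auto simp: path_graph_def)
  have "in": "{u. (u, i) \<in> parcs (path_graph n) \<and> C i < C u} =
      (if i < n \<and> C i < C (Suc i) then {Suc i} else {}) \<union>
      (if 1 < i \<and> C i < C (i - 1) then {i - 1} else {})"
    using assms by (auto simp: path_graph_def)
  show ?thesis
    using assms unfolding fire_def out "in" by (auto simp: path_flow_eq sgn_if)
qed

lemma p2_configuration_path_graph_iff:
  "p2_configuration (path_graph n) C \<longleftrightarrow>
    (\<forall>i\<in>{1..<n}. sgn (C (Suc i) - C i + path_flow n C (Suc i) + path_flow n C (i - 1)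
        - 2 * path_flow n C i) = - path_flow n C i) \<and>
    (\<exists>i\<in>{1..<n}. path_flow n C i \<noteq> 0)"
proof -
  define F where "F = fire (path_graph n) C"
  define s where "s = path_flow n C"
  define s' where "s' = path_flow n F"
  have F: "F i = C i + s i - s (i - 1)" if "i \<in> {1..n}" for i
    using fire_path_graph[OF that] by (simp add: F_def s_def)
  have F2: "fire (path_graph n) F i = F i + s' i - s' (i - 1)" if "i \<in> {1..n}" for i
    using fire_path_graph[OF that] by (simp add: s'_def)
  have s_out: "s i = 0" "s' i = 0" if "i \<notin> {1..<n}" for i
    using that by (simp_all only: s_def s'_def path_flow_eq if_False)
  have s': "s' i = sgn (C (Suc i) - C i + s (Suc i) + s (i - 1) - 2 * s i)"
    if "i \<in> {1..<n}" for i
    using that by (simp add: s'_def path_flow_eq F algebra_simps)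
  have verts: "pverts (path_graph n) = {1..n}" by (simp add: path_graph_def)
  have double: "same_config (path_graph n) (fire (path_graph n) F) C \<longleftrightarrow>
      (\<forall>i\<in>{1..<n}. s' i = - s i)" (is "?l \<longleftrightarrow> ?r")
  proof
    assume l: ?l
    \<comment> \<open>Returning to \<open>C\<close> makes \<open>s i + s' i\<close> constant in
      \<open>i\<close>; it vanishes at the fictitious edge \<open>0\<close>, hence
      everywhere.\<close>
    have "s' i = - s i" if "i \<le> n" for i
      using that
    proof (induction i)
      case 0
      show ?case by (simp add: s_out)
    next
      case (Suc i)
      have "fire (path_graph n) F (Suc i) = C (Suc i)" using l Suc.prems by (simp add: verts)
      then show ?case using Suc by (simp add: F F2)
    qed
    then show ?r by simp
  next
    assume ?r
    then have "s' i = - s i" for i using s_out[of i] by (cases "i \<in> {1..<n}") auto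
    then show ?l by (simp add: verts F F2)
  qed
  have fixed: "same_config (path_graph n) F C \<longleftrightarrow> (\<forall>i\<in>{1..<n}. s i = 0)" (is "?l \<longleftrightarrow> ?r")
  proof
    assume l: ?l
    have "s i = 0" if "i \<le> n" for i
      using that
    proof (induction i)
      case 0
      show ?case by (simp add: s_out)
    next
      case (Suc i)
      have "F (Suc i) = C (Suc i)" using l Suc.prems by (simp add: verts)
      then show ?case using Suc by (simp add: F)
    qed
    then show ?r by simp
  next
    assume ?r
    then have "s i = 0" for i using s_out[of i] by (cases "i \<in> {1..<n}") auto
    then show ?l by (simp add: verts F)
  qed
  show ?thesis
    using double fixed s'
    unfolding p2_configuration_iff[OF pair_graph_path_graph] F_def[symmetric] s_def[symmetric]
    by auto
qed

section \<open>Counting the values at one vertex\<close>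

text \<open>Once the flows are fixed, \<open>b\<close> is constrained only through the difference
  across edge \<open>k - 1\<close>, and any solution there can be realised without touching the
  other differences.\<close>

lemma p2_extension_values:
  assumes C: "p2_extension n R k a C" and k: "1 < k" "k \<le> n"
  shows "{b. \<exists>C'. p2_extension n R k a C' \<and> C' k = b} =
    {b. sgn (b - a (k - 1)) = flow R (k - 1) \<and>
        sgn (b - a (k - 1) + flow R k + flow R (k - 2) - 2 * flow R (k - 1)) = - flow R (k - 1)}"
    (is "?L = ?R")
proof (intro equalityI subsetI)
  have k': "k - 1 \<in> {1..<n}" "Suc (k - 1) = k" "k - 1 - 1 = k - 2" using k by auto
  {
    fix b assume "b \<in> ?L"
    then obtain D where D: "p2_extension n R k a D" "D k = b" by auto
    have R: "path_flow n D = flow R" using D by (simp add: p2_extension_def)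
    have a: "D (k - 1) = a (k - 1)" using D k by (simp add: p2_extension_def)
    have "sgn (D (Suc (k - 1)) - D (k - 1)) = flow R (k - 1)"
      using k' path_flow_eq[of n D "k - 1"] R by simp
    moreover have "sgn (D (Suc (k - 1)) - D (k - 1) + flow R (Suc (k - 1)) + flow R (k - 1 - 1)
        - 2 * flow R (k - 1)) = - flow R (k - 1)"
      using D k'(1) unfolding p2_extension_def p2_configuration_path_graph_iff R by blast
    ultimately show "b \<in> ?R" unfolding k' using a D(2) by simp
  }
  fix b assume b: "b \<in> ?R"
  \<comment> \<open>Shifting all vertices from \<open>k\<close> on by the same amount changes only
    the difference across edge \<open>k - 1\<close>.\<close>
  define D where "D i = (if i < k then C i else C i + (b - C k))" for i
  have a: "C (k - 1) = a (k - 1)" using C k by (simp add: p2_extension_def)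
  have R: "path_flow n C = flow R" using C by (simp add: p2_extension_def)
  have diff: "D (Suc i) - D i = (if i = k - 1 then b - a (k - 1) else C (Suc i) - C i)" for i
    using k a by (auto simp: D_def)
  have "induced_orientation (path_graph n) D = induced_orientation (path_graph n) C"
    unfolding induced_orientation_path_eq_iff
    using b k' path_flow_eq[of n C "k - 1"] by (auto simp: diff R)
  then have ori: "induced_orientation (path_graph n) D = R"
    using C by (simp add: p2_extension_def)
  have p2C: "\<forall>i\<in>{1..<n}. sgn (C (Suc i) - C i + flow R (Suc i) + flow R (i - 1)
      - 2 * flow R i) = - flow R i" "\<exists>i\<in>{1..<n}. flow R i \<noteq> 0"
    using C unfolding p2_extension_def p2_configuration_path_graph_iff R by blast+
  have "p2_configuration (path_graph n) D"
    unfolding p2_configuration_path_graph_iff ori diff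
    using p2C b k' by auto
  moreover have "D 1 = 0" "\<forall>i\<in>{1..<k}. D i = a i" "D k = b"
    using C k by (auto simp: D_def p2_extension_def)
  ultimately show "b \<in> ?L" using ori by (auto simp: p2_extension_def)
qed

text \<open>For \<open>s = 1\<close> the two signs say \<open>1 \<le> b - c \<le> 1 - m\<close>, and
  \<open>s = -1\<close> is the mirror image. For \<open>s = 0\<close> only \<open>b = c\<close> is
  possible, and \<open>m = 0\<close> makes it a solution.\<close>

lemma card_sgn_flip:
  fixes c m s :: int
  assumes s: "s \<in> {-1, 0, 1}" and "m * s \<le> 1"
    and "s = 0 \<Longrightarrow> m = 0"
  shows "card {b. sgn (b - c) = s \<and> sgn (b - c + m - 2 * s) = - s} = nat (1 - m * s)"
proof -
  consider "s = -1" | "s = 0" | "s = 1" using s by auto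
  then show ?thesis
  proof cases
    case 1
    then have "{b. sgn (b - c) = s \<and> sgn (b - c + m - 2 * s) = - s} = {c - 1 - m..c - 1}"
      by (auto simp: sgn_if split: if_splits)
    then show ?thesis using 1 by simp
  next
    case 2
    then have "{b. sgn (b - c) = s \<and> sgn (b - c + m - 2 * s) = - s} = {c}"
      using assms(3) by (auto simp: sgn_if split: if_splits)
    then show ?thesis using 2 by simp
  next
    case 3
    then have "{b. sgn (b - c) = s \<and> sgn (b - c + m - 2 * s) = - s} = {c + 1..c + 1 - m}"
      by (auto simp: sgn_if split: if_splits)
    then show ?thesis using 3 by simp
  qed
qed

section \<open>Which triples occur\<close>

lemma flow_range: "flow R i \<in> {-1, 0, 1}"
  by (simp add: flow_def split: edge_type.split)

text \<open>A positive difference \<open>x\<close> with \<open>x + m - 2 < 0\<close> forces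
  \<open>m \<le> 0\<close>, and symmetrically for a negative one; a zero difference must stay zero,
  so \<open>m = 0\<close>. Here \<open>m\<close> is the sum of the two neighbouring flows.\<close>

lemma p2_orientation_flow_local:
  assumes "p2_orientation (path_graph n) R" "i \<in> {1..<n}"
  shows "(flow R (Suc i) + flow R (i - 1)) * flow R i \<le> 0"
    and "flow R i = 0 \<Longrightarrow> flow R (Suc i) + flow R (i - 1) = 0"
proof -
  obtain C where C: "p2_configuration (path_graph n) C" and
    R: "induced_orientation (path_graph n) C = R"
    using assms(1) by (auto simp: p2_orientation_def)
  have x: "sgn (C (Suc i) - C i) = flow R i"
    using path_flow_eq[of n C i] assms(2) R by simp
  have y: "sgn (C (Suc i) - C i + flow R (Suc i) + flow R (i - 1) - 2 * flow R i) = - flow R i"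
    using C assms(2) unfolding p2_configuration_path_graph_iff R by blast
  show "flow R i = 0 \<Longrightarrow> flow R (Suc i) + flow R (i - 1) = 0"
    using x y by (simp add: sgn_if split: if_splits)
  show "(flow R (Suc i) + flow R (i - 1)) * flow R i \<le> 0"
    using x y flow_range[of R i] by (auto simp: sgn_if split: if_splits)
qed

text \<open>The flows on both sides of a flat edge cancel, so two adjacent zeros spread to both
  ends, against non-constancy. For \<open>i = 0\<close> this says that the end edge is not
  flat.\<close>

lemma p2_orientation_two_flat:
  assumes R: "p2_orientation (path_graph n) R" and i: "Suc i < n"
    and flat: "flow R i = 0" "flow R (Suc i) = 0"
  shows False
proof -
  have step: "flow R (Suc j) = - flow R (j - 1)" if "flow R j = 0" "j \<in> {1..<n}" for j
    using p2_orientation_flow_local(2)[OF R that(2,1)] by simp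
  have up: "j \<le> n \<Longrightarrow> i \<le> j \<Longrightarrow> flow R j = 0 \<and> (j < n \<longrightarrow> flow R (Suc j) = 0)" for j
  proof (induction j)
    case 0
    then show ?case using flat by simp
  next
    case (Suc j)
    show ?case
    proof (cases "i = Suc j")
      case True
      then show ?thesis using flat by simp
    next
      case False
      then show ?thesis using Suc step[of "Suc j"] by auto
    qed
  qed
  \<comment> \<open>Truncated subtraction keeps \<open>i - d\<close> at 0 for large
    \<open>d\<close>, so no bound on \<open>d\<close> is required.\<close>
  have down: "flow R (i - d) = 0 \<and> flow R (Suc (i - d)) = 0" for d
  proof (induction d)
    case 0
    show ?case using flat by simp
  next
    case (Suc d)
    show ?case
    proof (cases "i \<le> d")
      case True
      then show ?thesis using Suc by simp
    next
      case False
      then have "i - d \<in> {1..<n}" "Suc (i - Suc d) = i - d" "i - d - 1 = i - Suc d"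
        using i by auto
      then show ?thesis using Suc step[of "i - d"] by simp
    qed
  qed
  have "flow R j = 0" if "j < n" for j
    using up[of j] down[of "i - j"] that by (cases "i \<le> j") auto
  moreover obtain j where "j < n" "flow R j \<noteq> 0"
    using R by (auto simp: p2_orientation_def p2_configuration_path_graph_iff)
  ultimately show False by blast
qed

theorem theorem5:
  fixes n k :: nat and R :: "nat rel"
  assumes "n \<ge> 4"
    and "p2_orientation (path_graph n) R"
    and "3 \<le> k" and "k \<le> n - 1"
  shows "let T = (edge_type R k, edge_type R (k - 1), edge_type R (k - 2));
             T3 = {(Left, Right, Left), (Right, Left, Right)};
             T2 = {(Left, Right, Flat), (Right, Left, Flat),
                   (Flat, Right, Left), (Flat, Left, Right)};
             T1 = {(Left, Right, Right), (Right, Left, Left),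
                   (Left, Left, Right), (Right, Right, Left),
                   (Flat, Right, Flat), (Flat, Left, Flat),
                   (Left, Flat, Right), (Right, Flat, Left)}
         in (T \<in> T3 \<and> T \<notin> T2 \<and> T \<notin> T1 \<and> (\<forall>a. admissible n R k a \<longrightarrow> multiplier n R k a = 3)) \<or>
            (T \<notin> T3 \<and> T \<in> T2 \<and> T \<notin> T1 \<and> (\<forall>a. admissible n R k a \<longrightarrow> multiplier n R k a = 2)) \<or>
            (T \<notin> T3 \<and> T \<notin> T2 \<and> T \<in> T1 \<and> (\<forall>a. admissible n R k a \<longrightarrow> multiplier n R k a = 1))"
proof -
  have k: "k - 1 \<in> {1..<n}" "1 < k" "k \<le> n" "Suc (k - 1) = k" "k - 1 - 1 = k - 2"
    "Suc (k - 2) = k - 1" "Suc (k - 2) < n"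
    using assms by auto
  let ?m = "flow R k + flow R (k - 2)" and ?s = "flow R (k - 1)"
  have m: "?m * ?s \<le> 0" "?s = 0 \<Longrightarrow> ?m = 0"
    using p2_orientation_flow_local[OF assms(2) k(1)] by (simp_all only: k)
  \<comment> \<open>With a flat middle edge, \<open>m\<close> still admits the all-flat triple; this
    excludes it.\<close>
  have not_flat: "\<not> (flow R (k - 2) = 0 \<and> ?s = 0)"
    using p2_orientation_two_flat[OF assms(2) k(7)] k(6) by auto
  have mult: "multiplier n R k a = nat (1 - ?m * ?s)" if a: "admissible n R k a" for a
  proof -
    obtain C where "p2_extension n R k a C" using a by (auto simp: admissible_def)
    then have "multiplier n R k a =
      card {b. sgn (b - a (k - 1)) = ?s \<and> sgn (b - a (k - 1) + ?m - 2 * ?s) = - ?s}"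
      using p2_extension_values[of n R k a C] k by (simp add: multiplier_def add.assoc)
    then show ?thesis using card_sgn_flip[OF flow_range] m by simp
  qed
  show ?thesis
    \<comment> \<open>Of the 27 triples, \<open>m\<close> and \<open>not_flat\<close> leave the 14
      listed ones, where \<open>1 - ?m * ?s\<close> is 3, 2 or 1.\<close>
    using m not_flat mult unfolding flow_def Let_def
    by (cases "edge_type R k"; cases "edge_type R (k - 1)"; cases "edge_type R (k - 2)") simp_all
qed

end
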